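(* Let $h:\mathbb{R}^n\to\mathbb{R}$ and $g:\mathbb{R}^m\to\mathbb{R}$ be convex, closed, proper functions such that $h$ and $g^*$ are differentiable, with $g^*$ real-valued on $\mathbb{R}^m$, and let $A\in\mathbb{R}^{n\times m}$. Let $(y_\star,p_\star)$ be a primal-dual optimal point for the problem of minimizing $f(y)=h(Ay)+g(y)$ over $y\in\mathbb{R}^m$ and its dual of maximizing $d(p)=-h^*(-p)-g^*(A^Tp)$ over $p\in\mathbb{R}^n$, with $f(y_\star)=d(p_\star)$. Put $x_\star=Ay_\star$, $q_\star=A^Tp_\star$ and $$\mathrm{gap}(x,q)=h(x)-h(x_\star)+g^*(q)-g^*(q_\star)+x^Tp_\star-q^Ty_\star .$$ (i) If $(x_t,p_t)\in\mathbb{R}^n\times\mathbb{R}^n$, $t\ge0$, solves $$\dot x_t=A\nabla g^*(A^Tp_t)-x_t,\qquad \dot p_t=-\nabla h(x_t)-p_t,$$ then the partial duality gap $\mathrm{gap}(x_t,A^Tp_t)$ converges linearly to zero as $t\to\infty$. (ii) If $(y_t,q_t)\in\mathbb{R}^m\times\mathbb{R}^m$, $t\ge0$, solves $$\dot y_t=\nabla g^*(q_t)-y_t,\qquad \dot q_t=-A^T\nabla h(Ay_t)-q_t,$$ then the partial duality gap $\mathrm{gap}(Ay_t,q_t)$ converges linearly to zero as $t\to\infty$.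
   Context: For a function $f$, the convex conjugate is $f^*(p)=\sup_x (x^Tp-f(x))$. Primal-dual optimal means that $y_\star$ minimizes $f$ and $p_\star$ maximizes $d$. Solutions of the ODEs are differentiable curves defined for all $t\ge0$. A nonnegative function $\phi(t)$ converges to zero linearly (geometrically) if there are constants $C\ge 0$ and $c>0$ with $\phi(t)\le Ce^{-ct}$ for all $t\ge0$. *)

theory Defs
  imports "HOL-Analysis.Analysis"
begin

text \<open>The conjugate is extended-real-valued: the supremum may be infinite.\<close>

definition convex_conjugate :: "('a::real_inner \<Rightarrow> real) \<Rightarrow> 'a \<Rightarrow> ereal" where
  "convex_conjugate f p = (SUP x. ereal (x \<bullet> p - f x))"

definition real_conjugate :: "('a::real_inner \<Rightarrow> real) \<Rightarrow> 'a \<Rightarrow> real" where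
  "real_conjugate f p = real_of_ereal (convex_conjugate f p)"

text \<open>Properness is stated for extended-real-valued functions; for the real-valued
  functions it is applied to, it holds automatically.\<close>

definition proper_fun :: "('a \<Rightarrow> ereal) \<Rightarrow> bool" where
  "proper_fun f \<longleftrightarrow> (\<exists>x. f x \<noteq> \<infinity>) \<and> (\<forall>x. f x \<noteq> -\<infinity>)"

definition closed_proper_convex :: "('a::real_inner \<Rightarrow> real) \<Rightarrow> bool" where
  "closed_proper_convex f \<longleftrightarrow>
     convex_on UNIV f \<and> closed (epigraph UNIV f) \<and> proper_fun (\<lambda>x. ereal (f x))"

text \<open>Meaningful where \<open>f\<close> is differentiable; the gradient is then unique.\<close>

definition grad :: "('a::real_inner \<Rightarrow> real) \<Rightarrow> 'a \<Rightarrow> 'a" where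
  "grad f x = (THE D. GDERIV f x :> D)"

definition primal_obj ::
  "(real^'n \<Rightarrow> real) \<Rightarrow> (real^'m \<Rightarrow> real) \<Rightarrow> real^'m^'n \<Rightarrow> real^'m \<Rightarrow> real" where
  "primal_obj h g A y = h (A *v y) + g y"

definition dual_obj ::
  "(real^'n \<Rightarrow> real) \<Rightarrow> (real^'m \<Rightarrow> real) \<Rightarrow> real^'m^'n \<Rightarrow> real^'n \<Rightarrow> ereal" where
  "dual_obj h g A p = - convex_conjugate h (- p) - convex_conjugate g (transpose A *v p)"

definition primal_dual_optimal ::
  "(real^'n \<Rightarrow> real) \<Rightarrow> (real^'m \<Rightarrow> real) \<Rightarrow> real^'m^'n \<Rightarrow> real^'m \<Rightarrow> real^'n \<Rightarrow> bool" where
  "primal_dual_optimal h g A ys ps \<longleftrightarrow>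
     (\<forall>y. primal_obj h g A ys \<le> primal_obj h g A y) \<and>
     (\<forall>p. dual_obj h g A p \<le> dual_obj h g A ps)"

definition partial_gap ::
  "(real^'n \<Rightarrow> real) \<Rightarrow> (real^'m \<Rightarrow> real) \<Rightarrow> real^'m^'n \<Rightarrow> real^'m \<Rightarrow> real^'n \<Rightarrow>
   real^'n \<Rightarrow> real^'m \<Rightarrow> real" where
  "partial_gap h g A ys ps x q =
     (let xs = A *v ys; qs = transpose A *v ps in
      h x - h xs + real_conjugate g q - real_conjugate g qs + x \<bullet> ps - q \<bullet> ys)"

definition converges_linearly_to_zero :: "(real \<Rightarrow> real) \<Rightarrow> bool" where
  "converges_linearly_to_zero \<phi> \<longleftrightarrow>
     (\<forall>t\<ge>0. 0 \<le> \<phi> t) \<and> (\<exists>C\<ge>0. \<exists>c>0. \<forall>t\<ge>0. \<phi> t \<le> C * exp (- c * t))"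

text \<open>At \<open>t = 0\<close> the derivatives below are one-sided.\<close>

definition solves_xp_flow ::
  "(real^'n \<Rightarrow> real) \<Rightarrow> (real^'m \<Rightarrow> real) \<Rightarrow> real^'m^'n \<Rightarrow>
   (real \<Rightarrow> real^'n) \<Rightarrow> (real \<Rightarrow> real^'n) \<Rightarrow> bool" where
  "solves_xp_flow h g A x p \<longleftrightarrow>
     (\<forall>t\<ge>0.
       (x has_vector_derivative
          A *v grad (real_conjugate g) (transpose A *v p t) - x t) (at t within {0..}) \<and>
       (p has_vector_derivative - grad h (x t) - p t) (at t within {0..}))"

definition solves_yq_flow ::
  "(real^'n \<Rightarrow> real) \<Rightarrow> (real^'m \<Rightarrow> real) \<Rightarrow> real^'m^'n \<Rightarrow>
   (real \<Rightarrow> real^'m) \<Rightarrow> (real \<Rightarrow> real^'m) \<Rightarrow> bool" where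
  "solves_yq_flow h g A y q \<longleftrightarrow>
     (\<forall>t\<ge>0.
       (y has_vector_derivative grad (real_conjugate g) (q t) - y t) (at t within {0..}) \<and>
       (q has_vector_derivative
          - (transpose A *v grad h (A *v y t)) - q t) (at t within {0..}))"

end

theory Submission
  imports Defs
begin

text \<open>
  Both flows are the same flow seen through \<open>A\<close>: with \<open>q = A\<^sup>T p\<close> in the first and \<open>x = A y\<close> in
  the second, the pair \<open>(x, q)\<close> satisfies
  \<open>x' = A \<nabla>g\<^sup>*(q) - x\<close> and \<open>q' = - A\<^sup>T \<nabla>h(x) - q\<close>.
  Because \<open>\<langle>x\<^sub>\<star>, p\<^sub>\<star>\<rangle> = \<langle>y\<^sub>\<star>, q\<^sub>\<star>\<rangle>\<close>, the gap is the sum of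
  \<open>h(x) - h(x\<^sub>\<star>) + \<langle>x - x\<^sub>\<star>, p\<^sub>\<star>\<rangle>\<close> and
  \<open>g\<^sup>*(q) - g\<^sup>*(q\<^sub>\<star>) - \<langle>q - q\<^sub>\<star>, y\<^sub>\<star>\<rangle>\<close>.
  A vanishing duality gap forces equality in both Fenchel-Young inequalities, that is,
  \<open>- p\<^sub>\<star> \<in> \<partial>h(x\<^sub>\<star>)\<close> and \<open>y\<^sub>\<star> \<in> \<partial>g\<^sup>*(q\<^sub>\<star>)\<close>; hence both summands are nonnegative
  (\<open>partial_gap_nonneg\<close>).

  Along the flow the coupling terms \<open>\<langle>\<nabla>h(x), A \<nabla>g\<^sup>*(q)\<rangle>\<close> cancel, which leaves
  \<open>gap' = - \<langle>\<nabla>h(x) + p\<^sub>\<star>, x - x\<^sub>\<star>\<rangle> - \<langle>\<nabla>g\<^sup>*(q) - y\<^sub>\<star>, q - q\<^sub>\<star>\<rangle>\<close>.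
  Evaluating the tangent inequalities of \<open>h\<close> at \<open>x\<close> and of \<open>g\<^sup>*\<close> at \<open>q\<close> in the points
  \<open>x\<^sub>\<star>\<close> and \<open>q\<^sub>\<star>\<close> gives \<open>gap' \<le> - gap\<close>, so the gap is at most \<open>gap(0) exp(-t)\<close>
  (\<open>partial_gap_decay\<close>).
\<close>

section \<open>Gradients of convex functions\<close>

lemma GDERIV_grad:
  fixes f :: "'a::euclidean_space \<Rightarrow> real"
  assumes "f differentiable (at x)"
  shows "GDERIV f x :> grad f x"
proof -
  obtain f' where f': "(f has_derivative f') (at x)"
    using assms by (auto simp: differentiable_def)
  interpret f': linear f'
    using f' by (rule has_derivative_linear)
  \<comment> \<open>the Riesz representative of the derivative\<close>
  have "f' = (\<lambda>u. u \<bullet> adjoint f' 1)"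
    using adjoint_works[OF f'.linear_axioms, of _ 1] by auto
  then have D: "GDERIV f x :> adjoint f' 1"
    using f' by (simp add: gderiv_def)
  have "E = adjoint f' 1" if "GDERIV f x :> E" for E
  proof -
    have "(\<lambda>u. u \<bullet> E) = (\<lambda>u. u \<bullet> adjoint f' 1)"
      using that D has_derivative_unique unfolding gderiv_def by blast
    then show ?thesis
      by (metis vector_eq_ldot)
  qed
  with D show ?thesis
    unfolding grad_def by (rule theI)
qed

lemma convex_on_above_tangent_GDERIV:
  fixes f :: "'a::real_inner \<Rightarrow> real"
  assumes convex: "convex_on UNIV f" and D: "GDERIV f x :> D"
  shows "f x + (y - x) \<bullet> D \<le> f y"
proof -
  define \<phi> where "\<phi> s = f (x + s *\<^sub>R (y - x))" for s
  have "convex_on UNIV \<phi>"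
  proof (rule convex_onI)
    fix t a b :: real
    assume t: "0 < t" "t < 1"
    have "x + ((1 - t) *\<^sub>R a + t *\<^sub>R b) *\<^sub>R (y - x)
        = (1 - t) *\<^sub>R (x + a *\<^sub>R (y - x)) + t *\<^sub>R (x + b *\<^sub>R (y - x))"
      by (simp add: algebra_simps)
    then show "\<phi> ((1 - t) *\<^sub>R a + t *\<^sub>R b) \<le> (1 - t) * \<phi> a + t * \<phi> b"
      using convex_onD[OF convex, of t "x + a *\<^sub>R (y - x)" "x + b *\<^sub>R (y - x)"] t
      by (simp add: \<phi>_def)
  qed auto
  moreover have "(\<phi> has_real_derivative (y - x) \<bullet> D) (at 0)"
  proof -
    have line: "((\<lambda>s. x + s *\<^sub>R (y - x)) has_derivative (\<lambda>s. s *\<^sub>R (y - x))) (at 0)"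
      by (auto intro!: derivative_eq_intros)
    have "(f has_derivative (\<lambda>u. u \<bullet> D)) (at (x + 0 *\<^sub>R (y - x)))"
      using D by (simp add: gderiv_def)
    from has_derivative_compose[OF line this] show ?thesis
      unfolding \<phi>_def by (simp add: has_field_derivative_def mult_commute_abs)
  qed
  ultimately have "\<phi> 1 - \<phi> 0 \<ge> ((y - x) \<bullet> D) * (1 - 0)"
    by (intro convex_on_imp_above_tangent[where A = UNIV]) auto
  then show ?thesis
    by (simp add: \<phi>_def)
qed

lemma GDERIV_has_vector_derivative_compose:
  assumes "(x has_vector_derivative x') (at t within S)" and "GDERIV f (x t) :> D"
  shows "((\<lambda>s. f (x s)) has_real_derivative x' \<bullet> D) (at t within S)"
  using has_derivative_compose[of x "\<lambda>s. s *\<^sub>R x'" t S f "\<lambda>u. u \<bullet> D"] assms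
  by (simp add: has_vector_derivative_def gderiv_def has_field_derivative_def mult_commute_abs)

lemma GDERIV_inner_left: "GDERIV (\<lambda>u. u \<bullet> v) w :> v"
  by (simp add: gderiv_def bounded_linear_imp_has_derivative bounded_linear_inner_left)

section \<open>Conjugates\<close>

lemma fenchel_young:
  assumes "\<bar>convex_conjugate f p\<bar> \<noteq> \<infinity>"
  shows "x \<bullet> p - f x \<le> real_conjugate f p"
proof -
  have "ereal (x \<bullet> p - f x) \<le> convex_conjugate f p"
    unfolding convex_conjugate_def by (rule SUP_upper) simp
  also have "\<dots> = ereal (real_conjugate f p)"
    using assms by (simp add: real_conjugate_def ereal_real)
  finally show ?thesis by simp
qed

lemma real_conjugate_least:
  assumes "\<And>x. x \<bullet> p - f x \<le> c" and "\<bar>convex_conjugate f p\<bar> \<noteq> \<infinity>"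
  shows "real_conjugate f p \<le> c"
proof -
  have "convex_conjugate f p \<le> ereal c"
    unfolding convex_conjugate_def using assms(1) by (intro SUP_least) simp
  then have "ereal (real_conjugate f p) \<le> ereal c"
    using assms(2) by (simp add: real_conjugate_def ereal_real)
  then show ?thesis by simp
qed

lemma convex_on_real_conjugate:
  assumes finite: "\<And>p. \<bar>convex_conjugate f p\<bar> \<noteq> \<infinity>"
  shows "convex_on UNIV (real_conjugate f)"
proof (rule convex_onI)
  fix t :: real and p q
  assume t: "0 < t" "t < 1"
  show "real_conjugate f ((1 - t) *\<^sub>R p + t *\<^sub>R q)
      \<le> (1 - t) * real_conjugate f p + t * real_conjugate f q"
  proof (rule real_conjugate_least)
    fix x
    have "x \<bullet> ((1 - t) *\<^sub>R p + t *\<^sub>R q) - f x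
        = (1 - t) * (x \<bullet> p - f x) + t * (x \<bullet> q - f x)"
      by (simp add: inner_add_right algebra_simps)
    also have "\<dots> \<le> (1 - t) * real_conjugate f p + t * real_conjugate f q"
      using t fenchel_young[OF finite] by (intro add_mono mult_left_mono) auto
    finally show "x \<bullet> ((1 - t) *\<^sub>R p + t *\<^sub>R q) - f x
        \<le> (1 - t) * real_conjugate f p + t * real_conjugate f q" .
  qed (rule finite)
qed simp

section \<open>The partial duality gap\<close>

lemma inner_matrix_vector_transpose:
  fixes A :: "real^'m^'n"
  shows "(A *v y) \<bullet> p = y \<bullet> (transpose A *v p)"
  by (metis adjoint_matrix adjoint_works matrix_vector_mul_linear)

lemma partial_gap_eq:
  fixes A :: "real^'m^'n"
  shows "partial_gap h g A ys ps x q =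
     (h x - h (A *v ys) + (x - A *v ys) \<bullet> ps) +
     (real_conjugate g q - real_conjugate g (transpose A *v ps) - (q - transpose A *v ps) \<bullet> ys)"
  using inner_matrix_vector_transpose[of A ys ps]
  by (simp add: partial_gap_def Let_def inner_diff_left inner_diff_right inner_commute)

text \<open>Zero duality gap says that the two Fenchel-Young defects, at \<open>(x\<^sub>\<star>, - p\<^sub>\<star>)\<close> for \<open>h\<close> and
  at \<open>(y\<^sub>\<star>, q\<^sub>\<star>)\<close> for \<open>g\<close>, add up to zero. Comparing each with the inequality at an arbitrary
  point turns this into the two subgradient inequalities, added together.\<close>

lemma partial_gap_nonneg:
  fixes A :: "real^'m^'n"
  assumes finite: "\<And>q. \<bar>convex_conjugate g q\<bar> \<noteq> \<infinity>"
    and strong_duality: "ereal (primal_obj h g A ys) = dual_obj h g A ps"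
  shows "0 \<le> partial_gap h g A ys ps x q"
proof -
  let ?q = "transpose A *v ps"
  have g: "convex_conjugate g ?q = ereal (real_conjugate g ?q)"
    using finite by (simp add: real_conjugate_def ereal_real)
  have h_finite: "\<bar>convex_conjugate h (- ps)\<bar> \<noteq> \<infinity>"
    using strong_duality unfolding dual_obj_def g
    by (cases "convex_conjugate h (- ps)") auto
  then have h: "convex_conjugate h (- ps) = ereal (real_conjugate h (- ps))"
    by (simp add: real_conjugate_def ereal_real)
  have "h (A *v ys) + g ys = - real_conjugate h (- ps) - real_conjugate g ?q"
    using strong_duality unfolding dual_obj_def g h primal_obj_def by simp
  moreover have "x \<bullet> (- ps) - h x \<le> real_conjugate h (- ps)"
    using h_finite by (rule fenchel_young)
  moreover have "ys \<bullet> q - g ys \<le> real_conjugate g q"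
    using finite by (rule fenchel_young)
  ultimately show ?thesis
    by (simp add: partial_gap_def Let_def inner_commute)
qed

text \<open>The common form of the two flows. The gap is differentiable along it, one-sidedly at the
  left end, and the differential inequality \<open>gap' \<le> - gap\<close> makes \<open>exp(t) gap(t)\<close> nonincreasing.\<close>

lemma partial_gap_decay:
  fixes A :: "real^'m^'n"
  assumes h: "convex_on UNIV h" "\<And>x. h differentiable (at x)"
    and g: "convex_on UNIV (real_conjugate g)" "\<And>q. real_conjugate g differentiable (at q)"
    and x: "\<And>t. t \<ge> 0 \<Longrightarrow>
      (x has_vector_derivative A *v grad (real_conjugate g) (q t) - x t) (at t within {0..})"
    and q: "\<And>t. t \<ge> 0 \<Longrightarrow>
      (q has_vector_derivative - (transpose A *v grad h (x t)) - q t) (at t within {0..})"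
    and "t \<ge> 0"
  shows "partial_gap h g A ys ps (x t) (q t) \<le> partial_gap h g A ys ps (x 0) (q 0) * exp (- t)"
proof -
  let ?k = "real_conjugate g"
  let ?xs = "A *v ys" and ?qs = "transpose A *v ps"
  define V where "V t = partial_gap h g A ys ps (x t) (q t)" for t
  define V' where "V' t = (A *v grad ?k (q t) - x t) \<bullet> (grad h (x t) + ps)
      + (- (transpose A *v grad h (x t)) - q t) \<bullet> (grad ?k (q t) - ys)" for t
  have V: "(V has_real_derivative V' t) (at t within {0..})" if "t \<ge> 0" for t
  proof -
    note chain_x = GDERIV_has_vector_derivative_compose[OF x[OF that]]
    note chain_q = GDERIV_has_vector_derivative_compose[OF q[OF that]]
    show ?thesis
      using chain_x[OF GDERIV_grad[OF h(2)]] chain_q[OF GDERIV_grad[OF g(2)]]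
        chain_x[OF GDERIV_inner_left[of ps]] chain_q[OF GDERIV_inner_left[of ys]]
      unfolding V_def V'_def partial_gap_def Let_def
      by (auto intro!: derivative_eq_intros simp: inner_add_right inner_diff_right)
  qed
  have V'_le: "V' t \<le> - V t" for t
  proof -
    have "V' t = - ((x t - ?xs) \<bullet> (grad h (x t) + ps)) - (q t - ?qs) \<bullet> (grad ?k (q t) - ys)"
      using inner_matrix_vector_transpose[of A "grad ?k (q t)" "grad h (x t)"]
        inner_matrix_vector_transpose[of A "grad ?k (q t)" ps]
        inner_matrix_vector_transpose[of A ys "grad h (x t)"]
        inner_matrix_vector_transpose[of A ys ps]
      by (simp add: V'_def inner_simps inner_commute)
    moreover have "h (x t) + (?xs - x t) \<bullet> grad h (x t) \<le> h ?xs"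
      using h by (intro convex_on_above_tangent_GDERIV GDERIV_grad)
    moreover have "?k (q t) + (?qs - q t) \<bullet> grad ?k (q t) \<le> ?k ?qs"
      using g by (intro convex_on_above_tangent_GDERIV GDERIV_grad)
    ultimately show ?thesis
      unfolding V_def partial_gap_eq by (simp add: inner_simps)
  qed
  define W where "W t = exp t * V t" for t
  have W: "(W has_real_derivative exp t * (V t + V' t)) (at t within {0..})" if "t \<ge> 0" for t
    unfolding W_def using V[OF that]
    by (auto intro!: derivative_eq_intros simp: algebra_simps)
  have "W t \<le> W 0"
  proof (rule DERIV_nonpos_imp_decreasing_open[where f = W])
    show "0 \<le> t" by fact
    fix s assume "0 < s" "s < t"
    then have "at s within {0..} = at s"
      by (intro at_within_interior) auto
    then have "(W has_real_derivative exp s * (V s + V' s)) (at s)"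
      using W[of s] \<open>0 < s\<close> by simp
    moreover have "exp s * (V s + V' s) \<le> 0"
      using V'_le[of s] by (intro mult_nonneg_nonpos) auto
    ultimately show "\<exists>y. (W has_real_derivative y) (at s) \<and> y \<le> 0"
      by blast
  next
    have "continuous_on {0..} W"
      using W by (auto simp: continuous_on_eq_continuous_within intro: DERIV_continuous)
    then show "continuous_on {0..t} W"
      by (rule continuous_on_subset) auto
  qed
  then show ?thesis
    by (simp add: W_def V_def exp_minus field_simps)
qed

theorem mainTheorem2:
  fixes h :: "real^'n \<Rightarrow> real" and g :: "real^'m \<Rightarrow> real"
    and A :: "real^'m^'n"
    and ys :: "real^'m" and ps :: "real^'n"
  assumes "closed_proper_convex h" and "closed_proper_convex g"
    and "\<forall>q. \<bar>convex_conjugate g q\<bar> \<noteq> \<infinity>"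
    and "\<forall>x. h differentiable (at x)"
    and "\<forall>q. real_conjugate g differentiable (at q)"
    and "primal_dual_optimal h g A ys ps"
    and "ereal (primal_obj h g A ys) = dual_obj h g A ps"
  shows "(\<forall>x p. solves_xp_flow h g A x p \<longrightarrow>
            converges_linearly_to_zero (\<lambda>t. partial_gap h g A ys ps (x t) (transpose A *v p t))) \<and>
         (\<forall>y q. solves_yq_flow h g A y q \<longrightarrow>
            converges_linearly_to_zero (\<lambda>t. partial_gap h g A ys ps (A *v y t) (q t)))"
proof -
  have h: "convex_on UNIV h"
    using assms(1) by (simp add: closed_proper_convex_def)
  have g: "convex_on UNIV (real_conjugate g)"
    using assms(3) by (intro convex_on_real_conjugate) simp
  have nonneg: "0 \<le> partial_gap h g A ys ps x q" for x q
    using assms(3,7) by (intro partial_gap_nonneg) auto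
  have linear: "converges_linearly_to_zero (\<lambda>t. partial_gap h g A ys ps (x t) (q t))"
    if x: "\<And>t. t \<ge> 0 \<Longrightarrow>
        (x has_vector_derivative A *v grad (real_conjugate g) (q t) - x t) (at t within {0..})"
      and q: "\<And>t. t \<ge> 0 \<Longrightarrow>
        (q has_vector_derivative - (transpose A *v grad h (x t)) - q t) (at t within {0..})"
    for x q
  proof -
    have "partial_gap h g A ys ps (x t) (q t)
        \<le> partial_gap h g A ys ps (x 0) (q 0) * exp (- 1 * t)" if "t \<ge> 0" for t
      using partial_gap_decay[OF h _ g _ x q that] assms(4,5) by simp
    then show ?thesis
      unfolding converges_linearly_to_zero_def using nonneg by (meson zero_less_one)
  qed
  have push: "((\<lambda>t. B *v z t) has_vector_derivative B *v z') F"
    if "(z has_vector_derivative z') F"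
    for z and B :: "real^'k^'l" and z' and F
    using bounded_linear.has_vector_derivative[OF matrix_vector_mul_bounded_linear that] .
  have neg: "B *v (- u) = - (B *v u)" for B :: "real^'k^'l" and u
    by (rule linear_neg[OF matrix_vector_mul_linear])
  show ?thesis
  proof (intro conjI allI impI)
    fix x p
    assume "solves_xp_flow h g A x p"
    then show "converges_linearly_to_zero
        (\<lambda>t. partial_gap h g A ys ps (x t) (transpose A *v p t))"
      using push[of p _ _ "transpose A"] unfolding solves_xp_flow_def
      by (intro linear) (metis matrix_vector_mult_diff_distrib neg)+
  next
    fix y q
    assume "solves_yq_flow h g A y q"
    then show "converges_linearly_to_zero (\<lambda>t. partial_gap h g A ys ps (A *v y t) (q t))"
      using push[of y _ _ A] unfolding solves_yq_flow_def
      by (intro linear) (force simp: matrix_vector_mult_diff_distrib)+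
  qed
qed

end
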